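(* Let $D_0=\{0,1\}$ and, for $k\ge0$, let $u_k$ be the concatenation of all words of $D_k$ listed in lexicographic order (with $0<1$), and $D_{k+1}=u_kD_k^2=\{u_kw_1w_2: w_1,w_2\in D_k\}$. The sequence $(u_k)_{k\ge0}$ converges to an infinite word $\mathbf{u}=0100010101100111\cdots$. The abelian complexity of $\mathbf{u}$ is unbounded and $b^{(k)}_{\mathbf{u}}\prec b^{(k+1)}_{\mathbf{u}}$ for all $k\ge1$.
   Context: For words $u,w$, $\binom{u}{w}$ is the number of occurrences of $w$ as a scattered subword of $u$; $u\sim_k v$ if $\binom{u}{x}=\binom{v}{x}$ for all words $x$ of length at most $k$. $b^{(k)}_{\mathbf{x}}(n)$ is the number of $\sim_k$-classes among length-$n$ factors of $\mathbf{x}$ (for $k=1$, the abelian complexity). For $f,g\colon\mathbb{N}\to\mathbb{N}$, $f\prec g$ means $f(n)<g(n)$ for infinitely many $n$. *)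

theory Defs
  imports "HOL-Library.Omega_Words_Fun" "HOL-Library.List_Lexorder"
begin

text \<open>Finite words are lists, infinite words are functions on \<open>nat\<close>; the order on lists is
  the lexicographic one.\<close>

text \<open>An occurrence of \<open>w\<close> as a scattered subword of \<open>u\<close> is a set of positions of \<open>u\<close>
  whose letters, read from left to right, spell \<open>w\<close>.\<close>

definition word_binom :: "'a list \<Rightarrow> 'a list \<Rightarrow> nat" where
  "word_binom u w = card {I. I \<subseteq> {..<length u} \<and> nths u I = w}"

definition binom_equiv :: "nat \<Rightarrow> 'a list \<Rightarrow> 'a list \<Rightarrow> bool" where
  "binom_equiv k u v \<longleftrightarrow> (\<forall>x. length x \<le> k \<longrightarrow> word_binom u x = word_binom v x)"

definition factors :: "(nat \<Rightarrow> 'a) \<Rightarrow> nat \<Rightarrow> 'a list set" where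
  "factors x n = {x [i \<rightarrow> i + n] | i. True}"

definition binom_complexity :: "nat \<Rightarrow> (nat \<Rightarrow> 'a) \<Rightarrow> nat \<Rightarrow> nat" where
  "binom_complexity k x n = card (factors x n // {(u, v). binom_equiv k u v})"

abbreviation abelian_complexity :: "(nat \<Rightarrow> 'a) \<Rightarrow> nat \<Rightarrow> nat" where
  "abelian_complexity \<equiv> binom_complexity 1"

definition inf_often_less :: "(nat \<Rightarrow> nat) \<Rightarrow> (nat \<Rightarrow> nat) \<Rightarrow> bool" (infix \<open>\<prec>\<close> 50) where
  "f \<prec> g \<longleftrightarrow> infinite {n. f n < g n}"

text \<open>Convergence of finite words to an infinite word: every prefix of the limit is eventually
  a prefix of the members of the sequence (in particular their lengths tend to infinity).\<close>

definition words_converge :: "(nat \<Rightarrow> 'a list) \<Rightarrow> (nat \<Rightarrow> 'a) \<Rightarrow> bool" where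
  "words_converge s x \<longleftrightarrow>
     (\<forall>n. \<exists>K. \<forall>k\<ge>K. n \<le> length (s k) \<and> take n (s k) = x [0 \<rightarrow> n])"

definition lex_concat :: "'a::linorder list set \<Rightarrow> 'a list" where
  "lex_concat A = concat (sorted_list_of_set A)"

primrec D_seq :: "nat \<Rightarrow> nat list set" where
  "D_seq 0 = {[0], [1]}"
| "D_seq (Suc k) = {lex_concat (D_seq k) @ w1 @ w2 | w1 w2. w1 \<in> D_seq k \<and> w2 \<in> D_seq k}"

text \<open>\<open>sorted_list_of_set\<close> is meaningful on finite sets only.\<close>

lemma finite_D_seq: "finite (D_seq k)"
proof (induction k)
  case (Suc k)
  have "D_seq (Suc k) = (\<lambda>(w1, w2). lex_concat (D_seq k) @ w1 @ w2) ` (D_seq k \<times> D_seq k)"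
    by auto
  with Suc show ?case by simp
qed simp

definition u_seq :: "nat \<Rightarrow> nat list" where
  "u_seq k = lex_concat (D_seq k)"

text \<open>A sequence of words has at most one limit.\<close>

definition u_lim :: "nat \<Rightarrow> nat" where
  "u_lim = (THE x. words_converge u_seq x)"

end

theory Submission
  imports Defs "HOL-Library.Sublist"
begin

text \<open>
  If \<open>v \<sim>\<^sub>k w\<close>, then \<open>vw \<sim>\<^bsub>k+1\<^esub> wv\<close>; conversely, if \<open>k \<ge> 1\<close> and also \<open>vw \<sim>\<^bsub>k+2\<^esub> wv\<close>, then
  \<open>v \<sim>\<^bsub>k+1\<^esub> w\<close>. Since a common prefix is irrelevant for binomial equivalence, a pair \<open>v\<close>, \<open>w\<close> in
  \<open>D\<^sub>j\<close> separating \<open>\<sim>\<^sub>k\<close> from \<open>\<sim>\<^bsub>k+1\<^esub>\<close> yields the pair \<open>u\<^sub>jvw\<close>, \<open>u\<^sub>jwv\<close> in \<open>D\<^bsub>j+1\<^esub>\<close> separating the next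
  two relations, while \<open>u\<^sub>jvv\<close>, \<open>u\<^sub>jvw\<close> separates the same relations as before at a greater length.
  All words of \<open>D\<^sub>j\<close> have the same length and are factors of the limit, so each strict inequality
  of complexities holds for infinitely many lengths. The numbers of ones in the words of \<open>D\<^sub>j\<close> fill
  an interval with \<open>2\<^sup>j + 1\<close> elements, whence the unbounded abelian complexity.
\<close>

section \<open>Cardinalities of quotients\<close>

lemma card_image_le_card_quotient:
  assumes "finite A" and "equiv UNIV r" and "f respects r"
  shows "card (f ` A) \<le> card (A // r)"
proof -
  have "the_elem (f ` (r `` {a})) = f a" for a
  proof (rule the_elem_image_unique)
    show "r `` {a} \<noteq> {}" using equiv_class_self[OF \<open>equiv UNIV r\<close>, of a] by auto
    show "f b = f a" if "b \<in> r `` {a}" for b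
      using that \<open>f respects r\<close> by (auto simp: congruent_def)
  qed
  then have "f ` A = (\<lambda>X. the_elem (f ` X)) ` (A // r)"
    by (simp add: quotient_def UNION_singleton_eq_range image_image)
  moreover have "finite (A // r)" using \<open>finite A\<close> by (simp add: quotient_def)
  ultimately show ?thesis by (simp add: card_image_le)
qed

lemma card_quotient_less_if_refines:
  assumes "finite A" and equiv_r: "equiv UNIV r" and equiv_s: "equiv UNIV s" and "r \<subseteq> s"
    and "a \<in> A" "b \<in> A" and "(a, b) \<in> s" "(a, b) \<notin> r"
  shows "card (A // s) < card (A // r)"
proof -
  have s_class: "s `` (r `` {x}) = s `` {x}" for x
    using refines_equiv_class_eq2[OF \<open>r \<subseteq> s\<close> equiv_r equiv_s] .
  then have image_eq: "A // s = (\<lambda>X. s `` X) ` (A // r)"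
    by (simp add: quotient_def UNION_singleton_eq_range image_image)
  have finite_r: "finite (A // r)" using \<open>finite A\<close> by (simp add: quotient_def)
  have "\<not> inj_on (\<lambda>X. s `` X) (A // r)"
  proof
    assume "inj_on (\<lambda>X. s `` X) (A // r)"
    moreover have "s `` (r `` {a}) = s `` (r `` {b})"
      using \<open>(a, b) \<in> s\<close> by (simp add: s_class eq_equiv_class_iff[OF equiv_s])
    ultimately have "r `` {a} = r `` {b}"
      using \<open>a \<in> A\<close> \<open>b \<in> A\<close> by (simp add: inj_on_eq_iff quotientI)
    then show False using \<open>(a, b) \<notin> r\<close> by (simp add: eq_equiv_class_iff[OF equiv_r])
  qed
  then have "card ((\<lambda>X. s `` X) ` (A // r)) \<noteq> card (A // r)"
    using inj_on_iff_eq_card[OF finite_r] by blast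
  then show ?thesis
    unfolding image_eq using card_image_le[OF finite_r] by (simp add: order_less_le)
qed

section \<open>Binomial coefficients of words\<close>

definition occurrences :: "'a list \<Rightarrow> 'a list \<Rightarrow> nat set set" where
  "occurrences u w = {I \<in> Pow {..<length u}. nths u I = w}"

lemma word_binom_eq_card_occurrences: "word_binom u w = card (occurrences u w)"
  by (simp add: word_binom_def occurrences_def)

lemma finite_occurrences: "finite (occurrences u w)"
  by (simp add: occurrences_def)

lemma occurrences_Nil_right: "occurrences u [] = {{}}"
  by (auto simp: occurrences_def set_nths simp flip: set_empty)

lemma occurrences_Cons_Cons:
  "occurrences (a # u) (b # w) =
     image Suc ` occurrences u (b # w) \<union>
     (\<lambda>I. insert 0 (Suc ` I)) ` (if a = b then occurrences u w else {})"
proof -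
  have positions: "Pow {..<length (a # u)} =
      image Suc ` Pow {..<length u} \<union> (\<lambda>I. insert 0 (Suc ` I)) ` Pow {..<length u}"
    by (simp add: lessThan_Suc_eq_insert_0 Pow_insert image_image flip: image_Pow_surj[OF refl])
  have "nths (a # u) (Suc ` I) = nths u I" "nths (a # u) (insert 0 (Suc ` I)) = a # nths u I" for I
    by (simp_all add: nths_Cons inj_image_mem_iff)
  then show ?thesis
    unfolding occurrences_def positions by auto
qed

lemma word_binom_Nil_right [simp]: "word_binom u [] = 1"
  by (simp add: word_binom_eq_card_occurrences occurrences_Nil_right)

lemma word_binom_Nil_Cons [simp]: "word_binom [] (b # w) = 0"
  by (simp add: word_binom_def)

lemma word_binom_Cons_Cons [simp]:
  "word_binom (a # u) (b # w) = word_binom u (b # w) + (if a = b then word_binom u w else 0)"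
proof -
  have "inj (image Suc)" "inj (\<lambda>I. insert 0 (Suc ` I))"
    by (auto simp: inj_def inj_image_eq_iff insert_ident)
  then show ?thesis
    unfolding word_binom_eq_card_occurrences occurrences_Cons_Cons
    by (subst card_Un_disjoint) (auto simp: finite_occurrences card_image inj_on_subset)
qed

lemma word_binom_append:
  "word_binom (u @ v) x = (\<Sum>i\<le>length x. word_binom u (take i x) * word_binom v (drop i x))"
proof (induction u arbitrary: x)
  case Nil
  show ?case
    by (cases x) (simp_all add: sum.atMost_Suc_shift del: sum.atMost_Suc)
next
  case (Cons a u)
  show ?case
  proof (cases x)
    case (Cons b w)
    show ?thesis
      using Cons.IH[of x] Cons.IH[of w] unfolding Cons
      by (simp add: sum.atMost_Suc_shift sum.distrib algebra_simps del: sum.atMost_Suc)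
  qed simp
qed

lemma word_binom_singleton: "word_binom u [a] = count_list u a"
  by (induction u) auto

lemma word_binom_replicate: "word_binom u (replicate m a) = count_list u a choose m"
proof (induction u arbitrary: m)
  case Nil
  show ?case by (cases m) simp_all
next
  case (Cons b u)
  show ?case
  proof (cases m)
    case (Suc l)
    then show ?thesis using Cons.IH[of m] Cons.IH[of l] by simp
  qed simp
qed

section \<open>Binomial equivalence\<close>

lemma binom_equivD: "binom_equiv k u v \<Longrightarrow> length x \<le> k \<Longrightarrow> word_binom u x = word_binom v x"
  by (simp add: binom_equiv_def)

lemma equiv_binom_equiv: "equiv UNIV {(u, v). binom_equiv k u v}"
  by (auto intro!: equivI simp: refl_on_def sym_def trans_def binom_equiv_def)

lemma binom_equiv_count_list:
  assumes "binom_equiv k u v" and "1 \<le> k"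
  shows "count_list u a = count_list v a"
  using binom_equivD[OF assms(1), of "[a]"] assms(2) by (simp add: word_binom_singleton)

lemma binom_equiv_Cons_iff: "binom_equiv k (a # u) (a # v) \<longleftrightarrow> binom_equiv k u v"
proof
  assume equiv: "binom_equiv k (a # u) (a # v)"
  have "word_binom u x = word_binom v x" if "length x \<le> k" for x
    using that
  proof (induction x)
    case (Cons b x)
    then show ?case using binom_equivD[OF equiv, of "b # x"] by (simp split: if_splits)
  qed simp
  then show "binom_equiv k u v" by (simp add: binom_equiv_def)
next
  assume equiv: "binom_equiv k u v"
  have "word_binom (a # u) x = word_binom (a # v) x" if "length x \<le> k" for x
    using that by (cases x) (simp_all add: binom_equivD[OF equiv])
  then show "binom_equiv k (a # u) (a # v)" by (simp add: binom_equiv_def)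
qed

lemma binom_equiv_append_left_iff: "binom_equiv k (u @ v) (u @ w) \<longleftrightarrow> binom_equiv k v w"
  by (induction u) (simp_all add: binom_equiv_Cons_iff)

section \<open>Binomial equivalence of commuted products\<close>

definition binom_diff :: "'a list \<Rightarrow> 'a list \<Rightarrow> 'a list \<Rightarrow> int" where
  "binom_diff u v x = int (word_binom u x) - int (word_binom v x)"

lemma binom_diff_Nil [simp]: "binom_diff u v [] = 0"
  by (simp add: binom_diff_def)

lemma binom_equiv_iff_binom_diff:
  "binom_equiv k u v \<longleftrightarrow> (\<forall>x. length x \<le> k \<longrightarrow> binom_diff u v x = 0)"
  by (simp add: binom_equiv_def binom_diff_def)

lemma binom_diff_commute:
  "binom_diff (u @ v) (v @ u) x = (\<Sum>i=1..<length x.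
     binom_diff u v (take i x) * int (word_binom v (drop i x)) -
     int (word_binom v (take i x)) * binom_diff u v (drop i x))" (is "_ = sum ?f _")
proof -
  have "binom_diff (u @ v) (v @ u) x = (\<Sum>i\<le>length x. ?f i)"
    by (simp add: binom_diff_def word_binom_append algebra_simps flip: sum_subtractf)
  also have "\<dots> = (\<Sum>i=1..<length x. ?f i)"
  proof (cases "length x")
    case (Suc n)
    have "(\<Sum>i\<le>Suc n. ?f i) = ?f 0 + (\<Sum>i=1..<Suc n. ?f i) + ?f (Suc n)"
      by (simp add: atMost_atLeast0 sum.atLeast_Suc_atMost[of 0] atLeastLessThanSuc_atLeastAtMost)
    moreover have "?f 0 + ?f (Suc n) = 0" using Suc by simp
    ultimately show ?thesis using Suc by simp
  qed simp
  finally show ?thesis .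
qed

lemma binom_equiv_commute:
  assumes "binom_equiv k u v"
  shows "binom_equiv (Suc k) (u @ v) (v @ u)"
  unfolding binom_equiv_iff_binom_diff
proof (intro allI impI)
  fix x :: "'a list" assume "length x \<le> Suc k"
  then show "binom_diff (u @ v) (v @ u) x = 0"
    using assms unfolding binom_diff_commute binom_equiv_iff_binom_diff
    by (intro sum.neutral) auto
qed

lemma binom_diff_commute_Cons_snoc:
  assumes equiv: "binom_equiv k u v" and "1 \<le> k" and "length z = k"
  shows "binom_diff (u @ v) (v @ u) (c # z @ [a]) =
    binom_diff u v (c # z) * int (count_list v a) - int (count_list v c) * binom_diff u v (z @ [a])"
proof -
  let ?x = "c # z @ [a]"
  let ?f = "\<lambda>i. binom_diff u v (take i ?x) * int (word_binom v (drop i ?x)) -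
    int (word_binom v (take i ?x)) * binom_diff u v (drop i ?x)"
  have zero: "binom_diff u v y = 0" if "length y \<le> k" for y
    using equiv that by (simp add: binom_equiv_iff_binom_diff)
  have "binom_diff (u @ v) (v @ u) ?x = (\<Sum>i=1..<length ?x. ?f i)"
    by (rule binom_diff_commute)
  also have "\<dots> = (\<Sum>i\<in>{1, Suc k}. ?f i)"
    using assms by (intro sum.mono_neutral_right ballI) (auto simp: zero)
  also have "\<dots> = ?f (Suc k) + ?f 1" using \<open>1 \<le> k\<close> by simp
  also have "?f 1 = - int (count_list v c) * binom_diff u v (z @ [a])"
    using \<open>1 \<le> k\<close> by (simp add: zero word_binom_singleton)
  also have "?f (Suc k) = binom_diff u v (c # z) * int (count_list v a)"
    using assms by (simp add: zero word_binom_singleton)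
  finally show ?thesis by simp
qed

text \<open>
  By the previous identity, a leading letter of \<open>x\<close> may be exchanged for a trailing \<open>a\<close>. Repeating
  the exchange turns \<open>x\<close> into a power of \<open>a\<close>, whose coefficients depend only on the number of
  occurrences of \<open>a\<close>.
\<close>

lemma binom_diff_append_replicate_eq_0:
  assumes equiv: "binom_equiv k u v" and "1 \<le> k"
    and commute: "binom_equiv (Suc (Suc k)) (u @ v) (v @ u)"
    and "a \<in> set v" and "length x + m = Suc k"
  shows "binom_diff u v (x @ replicate m a) = 0"
  using \<open>length x + m = Suc k\<close>
proof (induction x arbitrary: m)
  case Nil
  have "count_list u a = count_list v a" using equiv \<open>1 \<le> k\<close> by (rule binom_equiv_count_list)
  then show ?case by (simp add: binom_diff_def word_binom_replicate)
next
  case (Cons c x)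
  let ?z = "x @ replicate m a"
  have "binom_diff (u @ v) (v @ u) (c # ?z @ [a]) = 0"
    using commute Cons.prems by (simp add: binom_equiv_iff_binom_diff)
  moreover have "binom_diff u v (?z @ [a]) = 0"
    using Cons.IH[of "Suc m"] Cons.prems by (simp add: replicate_append_same)
  ultimately have "binom_diff u v (c # ?z) * int (count_list v a) = 0"
    using binom_diff_commute_Cons_snoc[OF equiv \<open>1 \<le> k\<close>, of ?z c a] Cons.prems by simp
  then show ?case using \<open>a \<in> set v\<close> by (simp add: count_list_0_iff)
qed

lemma binom_equiv_Suc_if_commute:
  assumes equiv: "binom_equiv k u v" and "1 \<le> k"
    and commute: "binom_equiv (Suc (Suc k)) (u @ v) (v @ u)"
  shows "binom_equiv (Suc k) u v"
proof (cases v)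
  case Nil
  have "count_list u c = 0" for c
    using binom_equiv_count_list[OF equiv \<open>1 \<le> k\<close>] Nil by simp
  then have "u = []" by (metis count_list_0_iff list.set_intros(1) neq_Nil_conv)
  then show ?thesis using Nil by (simp add: binom_equiv_def)
next
  case (Cons a v')
  have "binom_diff u v x = 0" if "length x = Suc k" for x
    using binom_diff_append_replicate_eq_0[OF equiv \<open>1 \<le> k\<close> commute, of a x 0] that Cons by simp
  then show ?thesis using equiv by (simp add: binom_equiv_iff_binom_diff le_Suc_eq)
qed

definition binom_equiv_exactly :: "nat \<Rightarrow> 'a list \<Rightarrow> 'a list \<Rightarrow> bool" where
  "binom_equiv_exactly k u v \<longleftrightarrow> binom_equiv k u v \<and> \<not> binom_equiv (Suc k) u v"

lemma binom_equiv_exactly_append_left_iff: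
  "binom_equiv_exactly k (u @ v) (u @ w) \<longleftrightarrow> binom_equiv_exactly k v w"
  by (simp add: binom_equiv_exactly_def binom_equiv_append_left_iff)

lemma binom_equiv_exactly_commute:
  assumes "binom_equiv_exactly k u v" and "1 \<le> k"
  shows "binom_equiv_exactly (Suc k) (u @ v) (v @ u)"
  using assms binom_equiv_commute binom_equiv_Suc_if_commute
  unfolding binom_equiv_exactly_def by blast

lemma binom_equiv_exactly_two_letters:
  assumes "a \<noteq> b"
  shows "binom_equiv_exactly 1 [a, b] [b, a]"
proof -
  have "binom_equiv 0 [a] [b]" by (simp add: binom_equiv_def)
  then have "binom_equiv 1 [a, b] [b, a]" using binom_equiv_commute[of 0 "[a]" "[b]"] by simp
  moreover have "word_binom [a, b] [a, b] \<noteq> word_binom [b, a] [a, b]" using assms by simp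
  then have "\<not> binom_equiv (Suc 1) [a, b] [b, a]"
    by (auto dest: binom_equivD[where x = "[a, b]"] simp del: word_binom_Cons_Cons)
  ultimately show ?thesis by (simp add: binom_equiv_exactly_def)
qed

section \<open>Factors and binomial complexity\<close>

lemma finite_factors:
  assumes "finite (range x)"
  shows "finite (factors x n)"
proof (rule finite_subset)
  show "factors x n \<subseteq> {w. set w \<subseteq> range x \<and> length w = n}" by (auto simp: factors_def)
  show "finite {w. set w \<subseteq> range x \<and> length w = n}" using assms by (rule finite_lists_length_eq)
qed

lemma sublist_subsequence_mem_factors:
  assumes "sublist w (x [0 \<rightarrow> n])"
  shows "w \<in> factors x (length w)"
proof -
  obtain p q where split: "x [0 \<rightarrow> n] = p @ w @ q" using assms by (auto simp: sublist_def)
  have "n = length p + length w + length q" using arg_cong[OF split, of length] by simp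
  moreover have "w = take (length w) (drop (length p) (x [0 \<rightarrow> n]))" by (simp add: split)
  ultimately have "w = x [length p \<rightarrow> length p + length w]" by simp
  then show ?thesis unfolding factors_def by blast
qed

lemma binom_complexity_less_Suc:
  assumes "finite (range x)" and "u \<in> factors x n" "v \<in> factors x n" and "binom_equiv_exactly k u v"
  shows "binom_complexity k x n < binom_complexity (Suc k) x n"
  unfolding binom_complexity_def
proof (rule card_quotient_less_if_refines[OF finite_factors equiv_binom_equiv equiv_binom_equiv])
  show "{(u, v). binom_equiv (Suc k) u v} \<subseteq> {(u, v). binom_equiv k u v}"
    by (auto simp: binom_equiv_def)
  show "(u, v) \<in> {(u, v). binom_equiv k u v}" "(u, v) \<notin> {(u, v). binom_equiv (Suc k) u v}"
    using assms(4) by (simp_all add: binom_equiv_exactly_def)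
qed (use assms in auto)

lemma card_count_list_factors_le_abelian_complexity:
  assumes "finite (range x)"
  shows "card ((\<lambda>w. count_list w a) ` factors x n) \<le> abelian_complexity x n"
  unfolding binom_complexity_def
proof (rule card_image_le_card_quotient[OF finite_factors equiv_binom_equiv])
  show "(\<lambda>w. count_list w a) respects {(u, v). binom_equiv 1 u v}"
    by (auto simp: congruent_def dest: binom_equiv_count_list)
qed (fact assms)

section \<open>Convergence of words\<close>

lemma words_converge_unique:
  assumes "words_converge s x" and "words_converge s y"
  shows "x = y"
proof
  fix n
  obtain K where take_x: "\<And>k. k \<ge> K \<Longrightarrow> take (Suc n) (s k) = x [0 \<rightarrow> Suc n]"
    using assms(1) unfolding words_converge_def by meson
  obtain L where take_y: "\<And>k. k \<ge> L \<Longrightarrow> take (Suc n) (s k) = y [0 \<rightarrow> Suc n]"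
    using assms(2) unfolding words_converge_def by meson
  have "x [0 \<rightarrow> Suc n] = y [0 \<rightarrow> Suc n]"
    using take_x[of "max K L"] take_y[of "max K L"] by simp
  then show "x n = y n" by (simp add: subsequence_def)
qed

lemma words_converge_prefix_chain:
  assumes chain: "\<And>k. Sublist.prefix (s k) (s (Suc k))" and "\<And>n. \<exists>k. n < length (s k)"
  shows "\<exists>x. words_converge s x"
proof -
  have mono: "Sublist.prefix (s j) (s k)" if "j \<le> k" for j k
    using chain that by (rule prefix_order.lift_Suc_mono_le)
  obtain K where K_length: "\<And>n. n < length (s (K n))" using assms(2) by metis
  define x where "x n = s (K n) ! n" for n
  have nth: "s k ! i = x i" if "i < length (s k)" for i k
  proof (cases "k \<le> K i")
    case True
    from mono[OF this] that show ?thesis by (auto simp: x_def prefix_def nth_append)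
  next
    case False
    then have "Sublist.prefix (s (K i)) (s k)" by (simp add: mono)
    with K_length[of i] show ?thesis by (auto simp: x_def prefix_def nth_append)
  qed
  have "n \<le> length (s k) \<and> take n (s k) = x [0 \<rightarrow> n]" if "K n \<le> k" for n k
  proof -
    have "n \<le> length (s k)" using K_length[of n] prefix_length_le[OF mono[OF that]] by simp
    then show ?thesis by (auto intro!: nth_equalityI simp: nth)
  qed
  then show ?thesis unfolding words_converge_def by blast
qed

lemma prefix_chain_eq_subsequence_limit:
  assumes chain: "\<And>k. Sublist.prefix (s k) (s (Suc k))" and "words_converge s x"
  shows "s k = x [0 \<rightarrow> length (s k)]"
proof -
  let ?n = "length (s k)"
  obtain K where take_limit: "\<And>j. j \<ge> K \<Longrightarrow> take ?n (s j) = x [0 \<rightarrow> ?n]"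
    using assms(2) unfolding words_converge_def by meson
  have "Sublist.prefix (s k) (s (max k K))"
    using chain by (rule prefix_order.lift_Suc_mono_le) simp
  then have "s k = take ?n (s (max k K))" by (auto simp: prefix_def)
  then show ?thesis using take_limit by simp
qed

lemma range_limit_subset:
  assumes "words_converge s x"
  shows "range x \<subseteq> (\<Union>k. set (s k))"
proof
  fix a assume "a \<in> range x"
  then obtain n where "a = x n" by blast
  then have "a \<in> set (x [0 \<rightarrow> Suc n])" by auto
  moreover obtain k where "take (Suc n) (s k) = x [0 \<rightarrow> Suc n]"
    using assms unfolding words_converge_def by blast
  ultimately show "a \<in> (\<Union>k. set (s k))" by (metis UN_I UNIV_I in_set_takeD)
qed

section \<open>The words \<open>u\<^sub>k\<close> and their limit\<close>

declare D_seq.simps(2) [simp del]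

lemma D_seq_Suc: "D_seq (Suc k) = (\<lambda>(v, w). u_seq k @ v @ w) ` (D_seq k \<times> D_seq k)"
  by (auto simp: D_seq.simps(2) u_seq_def)

lemma D_seq_SucE:
  assumes "w \<in> D_seq (Suc k)"
  obtains w1 w2 where "w = u_seq k @ w1 @ w2" "w1 \<in> D_seq k" "w2 \<in> D_seq k"
  using assms by (auto simp: D_seq_Suc)

lemma D_seq_nonempty: "D_seq k \<noteq> {}"
  by (induction k) (auto simp: D_seq_Suc)

lemma sublist_u_seq:
  assumes "w \<in> D_seq k"
  shows "sublist w (u_seq k)"
proof -
  have "w \<in> set (sorted_list_of_set (D_seq k))" using assms by (simp add: finite_D_seq)
  then obtain vs ws where "sorted_list_of_set (D_seq k) = vs @ w # ws" by (meson split_list)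
  then show ?thesis by (simp add: u_seq_def lex_concat_def)
qed

lemma set_u_seq: "set (u_seq k) = \<Union> (set ` D_seq k)"
  by (simp add: u_seq_def lex_concat_def finite_D_seq)

lemma set_D_seq_subset: "w \<in> D_seq k \<Longrightarrow> set w \<subseteq> {0, 1}"
proof (induction k arbitrary: w)
  case (Suc k)
  from Suc.prems obtain w1 w2 where "w = u_seq k @ w1 @ w2" "w1 \<in> D_seq k" "w2 \<in> D_seq k"
    by (rule D_seq_SucE)
  moreover have "set (u_seq k) \<subseteq> {0, 1}" unfolding set_u_seq using Suc.IH by blast
  ultimately show ?case using Suc.IH[of w1] Suc.IH[of w2] by simp
qed auto

lemma set_u_seq_subset: "set (u_seq k) \<subseteq> {0, 1}"
  unfolding set_u_seq using set_D_seq_subset by blast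

lemma D_seq_length_eq: "v \<in> D_seq k \<Longrightarrow> w \<in> D_seq k \<Longrightarrow> length v = length w"
proof (induction k arbitrary: v w)
  case (Suc k)
  from Suc.prems(1) obtain v1 v2 where v_split: "v = u_seq k @ v1 @ v2" "v1 \<in> D_seq k" "v2 \<in> D_seq k"
    by (rule D_seq_SucE)
  from Suc.prems(2) obtain w1 w2 where w_split: "w = u_seq k @ w1 @ w2" "w1 \<in> D_seq k" "w2 \<in> D_seq k"
    by (rule D_seq_SucE)
  from v_split w_split show ?case using Suc.IH[of v1 w1] Suc.IH[of v2 w2] by simp
qed auto

lemma D_seq_length_gt: "w \<in> D_seq k \<Longrightarrow> k < length w"
proof (induction k arbitrary: w)
  case (Suc k)
  from Suc.prems obtain w1 w2 where "w = u_seq k @ w1 @ w2" "w1 \<in> D_seq k" "w2 \<in> D_seq k"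
    by (rule D_seq_SucE)
  then show ?case using Suc.IH[of w1] Suc.IH[of w2] by simp
qed auto

lemma u_seq_length_gt: "k < length (u_seq k)"
proof -
  obtain w where "w \<in> D_seq k" using D_seq_nonempty by blast
  then show ?thesis
    using D_seq_length_gt[of w k] sublist_length_le[OF sublist_u_seq, of w k] by simp
qed

lemma prefix_u_seq_Suc: "Sublist.prefix (u_seq k) (u_seq (Suc k))"
proof -
  have "sorted_list_of_set (D_seq (Suc k)) \<noteq> []" by (simp add: finite_D_seq D_seq_nonempty)
  then obtain w ws where sorted: "sorted_list_of_set (D_seq (Suc k)) = w # ws"
    by (meson list.exhaust)
  then have "w \<in> D_seq (Suc k)"
    by (metis finite_D_seq list.set_intros(1) set_sorted_list_of_set)
  then have "Sublist.prefix (u_seq k) w" by (auto elim: D_seq_SucE)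
  then show ?thesis using sorted by (simp add: u_seq_def[of "Suc k"] lex_concat_def)
qed

lemma words_converge_u_lim: "words_converge u_seq u_lim"
proof -
  have "\<exists>x. words_converge u_seq x"
    using prefix_u_seq_Suc u_seq_length_gt by (blast intro: words_converge_prefix_chain)
  then have "\<exists>!x. words_converge u_seq x" using words_converge_unique by blast
  then show ?thesis unfolding u_lim_def by (rule theI')
qed

lemma u_seq_eq_subsequence_u_lim: "u_seq k = u_lim [0 \<rightarrow> length (u_seq k)]"
  using prefix_u_seq_Suc words_converge_u_lim by (rule prefix_chain_eq_subsequence_limit)

lemma finite_range_u_lim: "finite (range u_lim)"
proof (rule finite_subset)
  show "range u_lim \<subseteq> {0, 1}"
    using range_limit_subset[OF words_converge_u_lim] UN_least[OF set_u_seq_subset]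
    by (rule order_trans)
qed simp

lemma D_seq_subset_factors:
  assumes "v \<in> D_seq k"
  shows "D_seq k \<subseteq> factors u_lim (length v)"
proof
  fix w assume w_in: "w \<in> D_seq k"
  have "sublist w (u_lim [0 \<rightarrow> length (u_seq k)])"
    using sublist_u_seq[OF w_in] u_seq_eq_subsequence_u_lim by (rule back_subst[of "sublist w"])
  then show "w \<in> factors u_lim (length v)"
    using sublist_subsequence_mem_factors D_seq_length_eq[OF assms w_in] by metis
qed

lemma u_lim_prefix_16: "u_lim [0 \<rightarrow> 16] = [0,1,0,0, 0,1,0,1, 0,1,1,0, 0,1,1,1]"
proof -
  have u_seq_0: "u_seq 0 = [0, 1]" by (simp add: u_seq_def lex_concat_def)
  have D_seq_1: "D_seq 1 = {[0,1,0,0], [0,1,0,1], [0,1,1,0], [0,1,1,1]}"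
    unfolding One_nat_def D_seq_Suc u_seq_0 by auto
  have u_seq_1: "u_seq 1 = [0,1,0,0, 0,1,0,1, 0,1,1,0, 0,1,1,1]"
    unfolding u_seq_def lex_concat_def D_seq_1 by simp
  have "length (u_seq 1) = 16" unfolding u_seq_1 by simp
  then show ?thesis using u_seq_eq_subsequence_u_lim[of 1] u_seq_1 by metis
qed

section \<open>Binomial equivalence and letter counts in \<open>D\<^sub>k\<close>\<close>

lemma D_seq_Suc_binom_equiv_exactly:
  assumes "v \<in> D_seq j" "w \<in> D_seq j" "binom_equiv_exactly k v w"
  shows "\<exists>v\<in>D_seq (Suc j). \<exists>w\<in>D_seq (Suc j). binom_equiv_exactly k v w"
proof (intro bexI)
  show "binom_equiv_exactly k (u_seq j @ v @ v) (u_seq j @ v @ w)"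
    using assms(3) by (simp add: binom_equiv_exactly_append_left_iff)
qed (use assms in \<open>auto simp: D_seq_Suc\<close>)

lemma D_seq_Suc_binom_equiv_exactly_Suc:
  assumes "v \<in> D_seq j" "w \<in> D_seq j" "binom_equiv_exactly k v w" and "1 \<le> k"
  shows "\<exists>v\<in>D_seq (Suc j). \<exists>w\<in>D_seq (Suc j). binom_equiv_exactly (Suc k) v w"
proof (intro bexI)
  show "binom_equiv_exactly (Suc k) (u_seq j @ v @ w) (u_seq j @ w @ v)"
    using assms(3,4) by (simp add: binom_equiv_exactly_append_left_iff binom_equiv_exactly_commute)
qed (use assms in \<open>auto simp: D_seq_Suc\<close>)

lemma D_seq_binom_equiv_exactly_diagonal:
  assumes "1 \<le> k"
  shows "\<exists>v\<in>D_seq k. \<exists>w\<in>D_seq k. binom_equiv_exactly k v w"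
  using assms
proof (induction k rule: nat_induct_at_least)
  case base
  show ?case
  proof (intro bexI)
    show "binom_equiv_exactly 1 (u_seq 0 @ [0, 1]) (u_seq 0 @ [1, 0])"
      unfolding binom_equiv_exactly_append_left_iff
      by (rule binom_equiv_exactly_two_letters) simp
  qed (auto simp: D_seq_Suc)
next
  case (Suc k)
  then show ?case using D_seq_Suc_binom_equiv_exactly_Suc by blast
qed

lemma D_seq_binom_equiv_exactly:
  assumes "1 \<le> k" and "k \<le> j"
  shows "\<exists>v\<in>D_seq j. \<exists>w\<in>D_seq j. binom_equiv_exactly k v w"
  using \<open>k \<le> j\<close>
proof (induction j rule: dec_induct)
  case base
  show ?case using D_seq_binom_equiv_exactly_diagonal[OF \<open>1 \<le> k\<close>] .
next
  case (step j)
  then show ?case using D_seq_Suc_binom_equiv_exactly by blast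
qed

lemma image_add_Times_atLeastAtMost_nat:
  fixes a b c d :: nat
  assumes "a \<le> b" and "c \<le> d"
  shows "(\<lambda>(m, n). m + n) ` ({a..b} \<times> {c..d}) = {a + c..b + d}"
proof (intro equalityI subsetI)
  fix n assume "n \<in> {a + c..b + d}"
  then have "(min b (n - c), n - min b (n - c)) \<in> {a..b} \<times> {c..d}"
    using assms by (auto simp: min_def)
  then show "n \<in> (\<lambda>(m, n). m + n) ` ({a..b} \<times> {c..d})"
    by (rule rev_image_eqI) simp
qed auto

lemma count_list_image_D_seq: "\<exists>c. (\<lambda>w. count_list w 1) ` D_seq j = {c..c + 2 ^ j}"
proof (induction j)
  case 0
  have "(\<lambda>w. count_list w 1) ` D_seq 0 = {0..0 + 2 ^ 0}" by auto
  then show ?case ..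
next
  case (Suc j)
  let ?count = "\<lambda>w. count_list w (1::nat)"
  obtain c where counts: "?count ` D_seq j = {c..c + 2 ^ j}" using Suc.IH by blast
  have "?count ` D_seq (Suc j) =
      (+) (?count (u_seq j)) ` (\<lambda>(m, n). m + n) ` (?count ` D_seq j \<times> ?count ` D_seq j)"
    by (force simp: D_seq_Suc image_image image_iff)
  also have "\<dots> = {?count (u_seq j) + 2 * c..?count (u_seq j) + 2 * c + 2 ^ Suc j}"
    unfolding counts by (simp add: image_add_Times_atLeastAtMost_nat algebra_simps)
  finally show ?case by blast
qed

section \<open>Complexity of the limit word\<close>

lemma abelian_complexity_u_lim_gt_power2: "\<exists>n. 2 ^ j < abelian_complexity u_lim n"
proof -
  obtain v where v_in: "v \<in> D_seq j" using D_seq_nonempty by blast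
  obtain c where counts: "(\<lambda>w. count_list w 1) ` D_seq j = {c..c + 2 ^ j}"
    using count_list_image_D_seq by blast
  have "2 ^ j < card ((\<lambda>w. count_list w 1) ` D_seq j)" unfolding counts by simp
  also have "\<dots> \<le> card ((\<lambda>w. count_list w 1) ` factors u_lim (length v))"
    by (intro card_mono image_mono finite_imageI finite_factors finite_range_u_lim
        D_seq_subset_factors v_in)
  also have "\<dots> \<le> abelian_complexity u_lim (length v)"
    by (rule card_count_list_factors_le_abelian_complexity[OF finite_range_u_lim])
  finally show ?thesis ..
qed

lemma binom_complexity_u_lim_less_Suc:
  assumes "1 \<le> k"
  shows "\<exists>n>m. binom_complexity k u_lim n < binom_complexity (Suc k) u_lim n"
proof -
  obtain v w where v_in: "v \<in> D_seq (k + m)" and w_in: "w \<in> D_seq (k + m)"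
      and exactly: "binom_equiv_exactly k v w"
    using D_seq_binom_equiv_exactly[OF assms, of "k + m"] by auto
  have "v \<in> factors u_lim (length v)" "w \<in> factors u_lim (length v)"
    using D_seq_subset_factors[OF v_in] v_in w_in by auto
  then have "binom_complexity k u_lim (length v) < binom_complexity (Suc k) u_lim (length v)"
    using finite_range_u_lim exactly by (intro binom_complexity_less_Suc)
  moreover have "m < length v" using D_seq_length_gt[OF v_in] by simp
  ultimately show ?thesis by blast
qed

theorem theorem6p4:
  shows "words_converge u_seq u_lim \<and>
         u_lim [0 \<rightarrow> 16] = [0,1,0,0, 0,1,0,1, 0,1,1,0, 0,1,1,1] \<and>
         \<not> bdd_above (range (abelian_complexity u_lim)) \<and>
         (\<forall>k\<ge>1. binom_complexity k u_lim \<prec> binom_complexity (k + 1) u_lim)"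
proof (intro conjI allI impI words_converge_u_lim u_lim_prefix_16)
  show "\<not> bdd_above (range (abelian_complexity u_lim))"
  proof
    assume "bdd_above (range (abelian_complexity u_lim))"
    then obtain B where bound: "\<And>n. abelian_complexity u_lim n \<le> B" by (auto simp: bdd_above_def)
    obtain n where "2 ^ B < abelian_complexity u_lim n"
      using abelian_complexity_u_lim_gt_power2 by blast
    then show False using bound[of n] less_exp[of B] by simp
  qed
next
  fix k :: nat assume "1 \<le> k"
  then show "binom_complexity k u_lim \<prec> binom_complexity (k + 1) u_lim"
    using binom_complexity_u_lim_less_Suc
    by (simp add: inf_often_less_def infinite_nat_iff_unbounded)
qed

end
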